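(* Let $U$ be a steady solution of the forced incompressible Navier--Stokes equations on $\Omega$, and let $v$ (divergence-free) satisfy the perturbation equation $$\partial_tv+P\big((U\cdot\nabla)v+(v\cdot\nabla)U+(v\cdot\nabla)v\big)-\nu P\Delta v=0 .$$ Assume there exists a (computable) constant $\gamma_U\ge0$ such that for all divergence-free $v\in V$, $$|\langle(v\cdot\nabla)U,v\rangle|\le\gamma_U\,\|v\|_H\,\|v\|_V .$$ Let $C_P$ be a Poincaré constant, so that $\|v\|_H\le C_P\|v\|_V$ for all $v\in V$. If $$\nu>\gamma_UC_P,$$ then the laminar state $U$ is energy stable in the sense that $$\frac12\frac{d}{dt}\|v(t)\|_H^2+(\nu-\gamma_UC_P)\,\|v(t)\|_V^2\le0,$$ and hence $\|v(t)\|_H$ is non-increasing and $v(t)\to0$ in $L^2(0,\infty;V)$.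
   Context: $\Omega\subset\mathbb R^d$, $d\in\{2,3\}$, is a bounded Lipschitz domain (or a torus) and $\nu>0$ is the viscosity. $V$ is the space of divergence-free $H^1$ fields satisfying the homogeneous no-slip (resp. periodic) boundary condition, with $\|v\|_V=\|\nabla v\|_{L^2}$; $H$ is the closure of $V$ in $L^2(\Omega)^d$ with the $L^2$ norm and inner product $\langle\cdot,\cdot\rangle$; $P$ is the Leray projector. $v=u-U$ is the perturbation of a solution $u$ of the Navier--Stokes equations with the same forcing. Standing assumption: the boundary conditions (periodic, or no-slip with compatible $U$) are such that the perturbation energy method closes, i.e. $v$ can be used as a test function and $\langle(U\cdot\nabla)v,v\rangle=0$, $\langle(v\cdot\nabla)v,v\rangle=0$. *)

theory Defs
  imports "HOL-Analysis.Analysis"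
begin

text \<open>
  Lebesgue and Sobolev spaces are sets of functions, not of equivalence classes; all operations
  below only depend on the almost-everywhere class on the flow domain.
\<close>

section \<open>Flow domains\<close>

text \<open>
  Near every boundary point, a bounded Lipschitz domain is the region above the graph of a
  Lipschitz function in some Cartesian frame. The last axis of the frame is the unit vector \<open>e\<close>;
  that \<open>g\<close> is a function of the remaining coordinates is expressed by its invariance along \<open>e\<close>.
\<close>

definition bounded_lipschitz_domain :: "(real ^ 'n) set \<Rightarrow> bool" where
  "bounded_lipschitz_domain \<Omega> \<longleftrightarrow>
     open \<Omega> \<and> connected \<Omega> \<and> \<Omega> \<noteq> {} \<and> bounded \<Omega> \<and>
     (\<forall>p \<in> frontier \<Omega>. \<exists>e g K r.
        norm e = 1 \<and> r > 0 \<and> K-lipschitz_on UNIV (g :: real ^ 'n \<Rightarrow> real) \<and>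
        (\<forall>x s. g (x + s *\<^sub>R e) = g x) \<and>
        \<Omega> \<inter> ball p r = {x \<in> ball p r. x \<bullet> e > g x})"

text \<open>
  \<open>No_Slip \<Omega>\<close> is the domain \<open>\<Omega>\<close> with homogeneous no-slip condition for the perturbation;
  \<open>Torus L\<close> is the torus with side lengths \<open>L $ i\<close>. Functions on the torus are represented by
  their values on the open fundamental cell; periodicity enters through the test functions.
\<close>

datatype ('n::finite) flow_domain = No_Slip "(real ^ 'n) set" | Torus "real ^ 'n"

primrec region :: "('n::finite) flow_domain \<Rightarrow> (real ^ 'n) set" where
  "region (No_Slip \<Omega>) = \<Omega>"
| "region (Torus L) = {x. \<forall>i. 0 < x $ i \<and> x $ i < L $ i}"

primrec valid_domain :: "('n::finite) flow_domain \<Rightarrow> bool" where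
  "valid_domain (No_Slip \<Omega>) \<longleftrightarrow> bounded_lipschitz_domain \<Omega>"
| "valid_domain (Torus L) \<longleftrightarrow> (\<forall>i. 0 < L $ i)"

section \<open>Test functions, weak gradients, and the spaces H and V\<close>

definition pderiv_at :: "'n \<Rightarrow> (real ^ 'n \<Rightarrow> real) \<Rightarrow> real ^ 'n \<Rightarrow> real" where
  "pderiv_at j f x = frechet_derivative f (at x) (axis j 1)"

primrec C_k :: "nat \<Rightarrow> (real ^ 'n \<Rightarrow> real) \<Rightarrow> bool" where
  "C_k 0 f \<longleftrightarrow> continuous_on UNIV f"
| "C_k (Suc k) f \<longleftrightarrow> (\<forall>x. f differentiable (at x)) \<and> (\<forall>j. C_k k (pderiv_at j f))"

definition smooth :: "(real ^ 'n \<Rightarrow> real) \<Rightarrow> bool" where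
  "smooth f \<longleftrightarrow> (\<forall>k. C_k k f)"

primrec test_fun :: "('n::finite) flow_domain \<Rightarrow> (real ^ 'n \<Rightarrow> real) \<Rightarrow> bool" where
  "test_fun (No_Slip \<Omega>) \<phi> \<longleftrightarrow>
     smooth \<phi> \<and> compact (closure {x. \<phi> x \<noteq> 0}) \<and> closure {x. \<phi> x \<noteq> 0} \<subseteq> \<Omega>"
| "test_fun (Torus L) \<phi> \<longleftrightarrow> smooth \<phi> \<and> (\<forall>x j. \<phi> (x + axis j (L $ j)) = \<phi> x)"

abbreviation dmeas :: "('n::finite) flow_domain \<Rightarrow> (real ^ 'n) measure" where
  "dmeas D \<equiv> lebesgue_on (region D)"

definition space_L2 :: "('n::finite) flow_domain \<Rightarrow> (real ^ 'n \<Rightarrow> 'b::euclidean_space) set" where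
  "space_L2 D = {u. u \<in> borel_measurable (dmeas D) \<and> integrable (dmeas D) (\<lambda>x. (norm (u x))\<^sup>2)}"

definition L2_inner ::
    "('n::finite) flow_domain \<Rightarrow> (real ^ 'n \<Rightarrow> 'b::euclidean_space) \<Rightarrow> (real ^ 'n \<Rightarrow> 'b) \<Rightarrow> real" where
  "L2_inner D u w = (\<integral>x. u x \<bullet> w x \<partial>dmeas D)"

text \<open>The norm of \<open>H\<close>.\<close>

definition L2_norm :: "('n::finite) flow_domain \<Rightarrow> (real ^ 'n \<Rightarrow> 'b::euclidean_space) \<Rightarrow> real" where
  "L2_norm D u = sqrt (\<integral>x. (norm (u x))\<^sup>2 \<partial>dmeas D)"

text \<open>
  Row \<open>i\<close>, column \<open>j\<close> of the gradient is the derivative of component \<open>i\<close> in direction \<open>j\<close>. Inner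
  product and norm on \<open>real ^ 'n ^ 'n\<close> are those of Frobenius. On the torus, where the test
  functions are all smooth periodic functions, this is the weak gradient of the periodic extension.
\<close>

definition has_weak_grad ::
    "('n::finite) flow_domain \<Rightarrow> (real ^ 'n \<Rightarrow> real ^ 'n) \<Rightarrow> (real ^ 'n \<Rightarrow> real ^ 'n ^ 'n) \<Rightarrow> bool" where
  "has_weak_grad D u G \<longleftrightarrow>
     G \<in> space_L2 D \<and>
     (\<forall>\<phi> i j. test_fun D \<phi> \<longrightarrow>
        (\<integral>x. u x $ i * pderiv_at j \<phi> x \<partial>dmeas D) = - (\<integral>x. G x $ i $ j * \<phi> x \<partial>dmeas D))"

definition wgrad ::
    "('n::finite) flow_domain \<Rightarrow> (real ^ 'n \<Rightarrow> real ^ 'n) \<Rightarrow> real ^ 'n \<Rightarrow> real ^ 'n ^ 'n" where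
  "wgrad D u = (SOME G. has_weak_grad D u G)"

definition space_H1 :: "('n::finite) flow_domain \<Rightarrow> (real ^ 'n \<Rightarrow> real ^ 'n) set" where
  "space_H1 D = {u \<in> space_L2 D. \<exists>G. has_weak_grad D u G}"

definition H1_norm :: "('n::finite) flow_domain \<Rightarrow> (real ^ 'n \<Rightarrow> real ^ 'n) \<Rightarrow> real" where
  "H1_norm D u = sqrt ((L2_norm D u)\<^sup>2 + (L2_norm D (wgrad D u))\<^sup>2)"

definition div_free :: "('n::finite) flow_domain \<Rightarrow> (real ^ 'n \<Rightarrow> real ^ 'n) \<Rightarrow> bool" where
  "div_free D u \<longleftrightarrow> (AE x in dmeas D. (\<Sum>i\<in>UNIV. wgrad D u x $ i $ i) = 0)"

text \<open>
  No-slip: \<open>u\<close> lies in the \<open>H\<^sup>1\<close>-closure of the smooth compactly supported fields. Torus: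
  periodicity is already part of \<open>space_H1\<close>; as usual, the mean is normalised to zero, since
  otherwise \<open>\<parallel>\<nabla>u\<parallel>\<close> is not a norm and no Poincare constant exists.
\<close>

primrec boundary_cond :: "('n::finite) flow_domain \<Rightarrow> (real ^ 'n \<Rightarrow> real ^ 'n) \<Rightarrow> bool" where
  "boundary_cond (No_Slip \<Omega>) u \<longleftrightarrow>
     (\<forall>\<epsilon>>0. \<exists>\<phi>. (\<forall>i. test_fun (No_Slip \<Omega>) (\<lambda>x. \<phi> x $ i)) \<and>
        H1_norm (No_Slip \<Omega>) (\<lambda>x. u x - \<phi> x) < \<epsilon>)"
| "boundary_cond (Torus L) u \<longleftrightarrow> (\<integral>x. u x \<partial>dmeas (Torus L)) = 0"

definition space_V :: "('n::finite) flow_domain \<Rightarrow> (real ^ 'n \<Rightarrow> real ^ 'n) set" where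
  "space_V D = {u \<in> space_H1 D. div_free D u \<and> boundary_cond D u}"

definition V_inner ::
    "('n::finite) flow_domain \<Rightarrow> (real ^ 'n \<Rightarrow> real ^ 'n) \<Rightarrow> (real ^ 'n \<Rightarrow> real ^ 'n) \<Rightarrow> real" where
  "V_inner D u w = L2_inner D (wgrad D u) (wgrad D w)"

definition V_norm :: "('n::finite) flow_domain \<Rightarrow> (real ^ 'n \<Rightarrow> real ^ 'n) \<Rightarrow> real" where
  "V_norm D u = L2_norm D (wgrad D u)"

definition space_H :: "('n::finite) flow_domain \<Rightarrow> (real ^ 'n \<Rightarrow> real ^ 'n) set" where
  "space_H D = {u \<in> space_L2 D. \<forall>\<epsilon>>0. \<exists>w \<in> space_V D. L2_norm D (\<lambda>x. u x - w x) < \<epsilon>}"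

section \<open>The Navier--Stokes and perturbation equations\<close>

text \<open>
  The terms of the equations are functionals on vector fields: \<open>advect D u w\<close> is \<open>(u\<cdot>\<nabla>)w\<close>, acting
  by the \<open>L\<^sup>2\<close> pairing, and \<open>laplacian D u\<close> is \<open>\<Delta>u\<close>, acting through integration by parts.
\<close>

type_synonym 'n functional = "(real ^ 'n \<Rightarrow> real ^ 'n) \<Rightarrow> real"

definition advect ::
    "('n::finite) flow_domain \<Rightarrow> (real ^ 'n \<Rightarrow> real ^ 'n) \<Rightarrow> (real ^ 'n \<Rightarrow> real ^ 'n) \<Rightarrow> 'n functional" where
  "advect D u w = (\<lambda>\<phi>. L2_inner D (\<lambda>x. wgrad D w x *v u x) \<phi>)"

definition laplacian ::
    "('n::finite) flow_domain \<Rightarrow> (real ^ 'n \<Rightarrow> real ^ 'n) \<Rightarrow> 'n functional" where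
  "laplacian D u = (\<lambda>\<phi>. - V_inner D u \<phi>)"

text \<open>
  The Leray projector on functionals. For \<open>f\<close> in \<open>L\<^sup>2\<close>, the orthogonal projection \<open>Pf\<close> onto \<open>H\<close> is
  the element of \<open>H\<close> with \<open>\<langle>Pf, \<phi>\<rangle> = \<langle>f, \<phi>\<rangle>\<close> for all \<open>\<phi>\<close> in the dense subspace \<open>V\<close>; so projecting
  a functional means restricting it to \<open>V\<close>, which annihilates gradients.
\<close>

definition leray :: "('n::finite) flow_domain \<Rightarrow> 'n functional \<Rightarrow> 'n functional" where
  "leray D F = (\<lambda>\<phi>. if \<phi> \<in> space_V D then F \<phi> else 0)"

definition V_dual :: "('n::finite) flow_domain \<Rightarrow> 'n functional set" where
  "V_dual D = {F.
     (\<forall>\<phi> \<in> space_V D. \<forall>\<psi> \<in> space_V D. \<forall>a b.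
        F (\<lambda>x. a *\<^sub>R \<phi> x + b *\<^sub>R \<psi> x) = a * F \<phi> + b * F \<psi>) \<and>
     (\<exists>C. \<forall>\<phi> \<in> space_V D. \<bar>F \<phi>\<bar> \<le> C * V_norm D \<phi>)}"

text \<open>
  \<open>P((U\<cdot>\<nabla>)U) - \<nu>P\<Delta>U = Pf\<close> with \<open>div U = 0\<close>, for a steady forcing \<open>f\<close>. The laminar state need not
  satisfy homogeneous boundary conditions (e.g. Couette flow).
\<close>

definition steady_NS ::
    "('n::finite) flow_domain \<Rightarrow> real \<Rightarrow> 'n functional \<Rightarrow> (real ^ 'n \<Rightarrow> real ^ 'n) \<Rightarrow> bool" where
  "steady_NS D \<nu> f U \<longleftrightarrow>
     U \<in> space_H1 D \<and> div_free D U \<and>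
     (\<forall>\<phi> \<in> space_V D.
        leray D (advect D U U) \<phi> - \<nu> * leray D (laplacian D U) \<phi> = leray D f \<phi>)"

text \<open>
  \<open>L\<^sup>2(I;V)\<close> for a set \<open>I\<close> of times. As \<open>V\<close> is separable, weak measurability is Bochner
  measurability.
\<close>

definition in_L2_V ::
    "('n::finite) flow_domain \<Rightarrow> real set \<Rightarrow> (real \<Rightarrow> real ^ 'n \<Rightarrow> real ^ 'n) \<Rightarrow> bool" where
  "in_L2_V D I v \<longleftrightarrow>
     (AE t in lebesgue_on I. v t \<in> space_V D) \<and>
     (\<forall>\<phi> \<in> space_V D. (\<lambda>t. V_inner D (v t) \<phi>) \<in> borel_measurable (lebesgue_on I)) \<and>
     integrable (lebesgue_on I) (\<lambda>t. (V_norm D (v t))\<^sup>2)"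

definition L2_V_norm ::
    "('n::finite) flow_domain \<Rightarrow> real set \<Rightarrow> (real \<Rightarrow> real ^ 'n \<Rightarrow> real ^ 'n) \<Rightarrow> real" where
  "L2_V_norm D I v = sqrt (\<integral>t. (V_norm D (v t))\<^sup>2 \<partial>lebesgue_on I)"

text \<open>\<open>v'\<close> is the weak time derivative of \<open>v\<close>, with values in the dual of \<open>V\<close>.\<close>

definition has_time_deriv ::
    "('n::finite) flow_domain \<Rightarrow> (real \<Rightarrow> real ^ 'n \<Rightarrow> real ^ 'n) \<Rightarrow> (real \<Rightarrow> 'n functional) \<Rightarrow> bool" where
  "has_time_deriv D v v' \<longleftrightarrow>
     (AE t in lebesgue_on {0..}. v' t \<in> V_dual D) \<and>
     (\<forall>\<phi> \<in> space_V D. \<forall>t\<ge>0.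
        integrable (lebesgue_on {0..t}) (\<lambda>s. v' s \<phi>) \<and>
        L2_inner D (v t) \<phi> - L2_inner D (v 0) \<phi> = (\<integral>s. v' s \<phi> \<partial>lebesgue_on {0..t}))"

text \<open>
  \<open>\<partial>\<^sub>tv + P((U\<cdot>\<nabla>)v + (v\<cdot>\<nabla>)U + (v\<cdot>\<nabla>)v) - \<nu>P\<Delta>v = 0\<close> in the dual of \<open>V\<close> for almost every time.
\<close>

definition perturbation_solution ::
    "('n::finite) flow_domain \<Rightarrow> real \<Rightarrow> (real ^ 'n \<Rightarrow> real ^ 'n) \<Rightarrow>
     (real \<Rightarrow> real ^ 'n \<Rightarrow> real ^ 'n) \<Rightarrow> (real \<Rightarrow> 'n functional) \<Rightarrow> bool" where
  "perturbation_solution D \<nu> U v v' \<longleftrightarrow>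
     (\<forall>t\<ge>0. v t \<in> space_H D) \<and>
     (\<forall>T\<ge>0. in_L2_V D {0..T} v) \<and>
     has_time_deriv D v v' \<and>
     (AE t in lebesgue_on {0..}. \<forall>\<phi> \<in> space_V D.
        v' t \<phi>
        + leray D (\<lambda>\<psi>. advect D U (v t) \<psi> + advect D (v t) U \<psi> + advect D (v t) (v t) \<psi>) \<phi>
        - \<nu> * leray D (laplacian D (v t)) \<phi> = 0)"

text \<open>
  The standing assumption that the perturbation energy method closes. That \<open>v\<close> itself can be used
  as a test function means that pairing with \<open>v\<close> is legitimate for the time derivative,
  \<open>\<langle>\<partial>\<^sub>tv, v\<rangle> = d/dt (\<parallel>v\<parallel>\<^sup>2/2)\<close>, here in integrated form: the equation holds on all of \<open>V\<close> for almost
  every time, so nothing is needed for the other terms. This is automatic for smooth \<open>v\<close> and when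
  \<open>\<partial>\<^sub>tv\<close> is locally square integrable in time with values in the dual of \<open>V\<close>.
\<close>

definition energy_method_closes ::
    "('n::finite) flow_domain \<Rightarrow> (real ^ 'n \<Rightarrow> real ^ 'n) \<Rightarrow>
     (real \<Rightarrow> real ^ 'n \<Rightarrow> real ^ 'n) \<Rightarrow> (real \<Rightarrow> 'n functional) \<Rightarrow> bool" where
  "energy_method_closes D U v v' \<longleftrightarrow>
     (\<forall>t\<ge>0. integrable (lebesgue_on {0..t}) (\<lambda>s. v' s (v s)) \<and>
        (L2_norm D (v t))\<^sup>2 / 2 - (L2_norm D (v 0))\<^sup>2 / 2 = (\<integral>s. v' s (v s) \<partial>lebesgue_on {0..t})) \<and>
     (AE t in lebesgue_on {0..}. advect D U (v t) (v t) = 0 \<and> advect D (v t) (v t) (v t) = 0)"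

end

theory Submission
  imports Defs
begin

text \<open>
  Testing the perturbation equation with \<open>v\<close> itself gives, for almost every time,
  \<open>\<langle>\<partial>\<^sub>tv, v\<rangle> = - \<langle>(v\<cdot>\<nabla>)U, v\<rangle> - \<nu>\<parallel>v\<parallel>\<^sub>V\<^sup>2\<close>, because the other two advection terms
  vanish. The bound on the production term and the Poincare inequality turn this into
  \<open>\<langle>\<partial>\<^sub>tv, v\<rangle> \<le> - (\<nu> - \<gamma>\<^sub>U C\<^sub>P)\<parallel>v\<parallel>\<^sub>V\<^sup>2\<close> (\<open>energy_dissipation_bound\<close>).

  The energy is the indefinite integral of \<open>2\<langle>\<partial>\<^sub>tv, v\<rangle>\<close>. By Lebesgue's differentiation theorem
  (\<open>AE_deriv_of_indefinite_integral\<close>) it is differentiable at almost every time, with derivative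
  \<open>2\<langle>\<partial>\<^sub>tv, v\<rangle>\<close>, so that the bound is the pointwise energy inequality. Integrated over \<open>[s, t]\<close>,
  it gives the energy balance
  \<open>\<parallel>v(t)\<parallel>\<^sub>H\<^sup>2 + 2(\<nu> - \<gamma>\<^sub>U C\<^sub>P) \<integral>\<^sub>s\<^sup>t \<parallel>v\<parallel>\<^sub>V\<^sup>2 \<le> \<parallel>v(s)\<parallel>\<^sub>H\<^sup>2\<close>
  (\<open>energy_balance_from_rate\<close>), which shows that the energy does not increase, and that the
  dissipation integrals over \<open>[0, T]\<close> are bounded uniformly in \<open>T\<close>. Hence
  \<open>\<parallel>v\<parallel>\<^sub>V\<^sup>2\<close> is integrable over the half-line, and its tail integrals tend to zero.
\<close>

section \<open>Lebesgue differentiation on the real line\<close>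

text \<open>
  The two-sided statement follows from the one-sided averages over \<open>[x, x + h]\<close>, applied to the
  function and to its reflection.
\<close>

lemma negligible_deriv_of_integral:
  fixes f :: "real \<Rightarrow> real"
  assumes f: "\<And>a b. f integrable_on {a..b}"
  obtains N where "negligible N"
    "\<And>a x. a < x \<Longrightarrow> x \<notin> N \<Longrightarrow> ((\<lambda>t. integral {a..t} f) has_real_derivative f x) (at x)"
proof -
  obtain N1 where N1: "negligible N1"
    and right: "\<And>x e. x \<notin> N1 \<Longrightarrow> 0 < e \<Longrightarrow>
      \<exists>d>0. \<forall>h. 0 < h \<and> h < d \<longrightarrow> \<bar>integral {x..x + h} f / h - f x\<bar> < e"
    using integrable_ccontinuous_explicit[of f] f by (auto simp: field_simps)
  have "(\<lambda>x. f (- x)) integrable_on {a..b}" for a b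
    using f[of "- b" "- a"] Henstock_Kurzweil_Integration.integrable_reflect_real[where f = f and a = "- b" and b = "- a"] by simp
  then obtain N2 where N2: "negligible N2"
    and left: "\<And>x e. x \<notin> N2 \<Longrightarrow> 0 < e \<Longrightarrow>
      \<exists>d>0. \<forall>h. 0 < h \<and> h < d \<longrightarrow> \<bar>integral {x..x + h} (\<lambda>x. f (- x)) / h - f (- x)\<bar> < e"
    using integrable_ccontinuous_explicit[of "\<lambda>x. f (- x)"] by (auto simp: field_simps)
  show thesis
  proof
    show "negligible (N1 \<union> uminus ` N2)"
      using N1 N2 by (intro negligible_Un negligible_differentiable_image_negligible)
        (auto intro: differentiable_on_minus differentiable_on_id)
  next
    fix a x :: real
    assume "a < x" and x: "x \<notin> N1 \<union> uminus ` N2"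
    have x1: "x \<notin> N1" and x2: "- x \<notin> N2"
      using x by (auto simp: image_iff)
    have split: "integral {a..q} f - integral {a..p} f = integral {p..q} f"
      if "a \<le> p" "p \<le> q" for p q
      using Henstock_Kurzweil_Integration.integral_combine[OF that f] by simp
    have refl: "integral {- x..- x + h} (\<lambda>x. f (- x)) = integral {x - h..x} f" for h
      using Henstock_Kurzweil_Integration.integral_reflect_real[of x "x - h" f] by (simp add: algebra_simps)
    show "((\<lambda>t. integral {a..t} f) has_real_derivative f x) (at x)"
      unfolding DERIV_def LIM_eq
    proof (intro allI impI)
      fix e :: real
      assume e: "0 < e"
      obtain d1 where d1: "d1 > 0"
        "\<And>h. 0 < h \<Longrightarrow> h < d1 \<Longrightarrow> \<bar>integral {x..x + h} f / h - f x\<bar> < e"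
        using right[OF x1 e] by blast
      obtain d2 where d2: "d2 > 0"
        "\<And>h. 0 < h \<Longrightarrow> h < d2 \<Longrightarrow> \<bar>integral {x - h..x} f / h - f x\<bar> < e"
        using left[OF x2 e] unfolding refl by auto
      define d where "d = min (min d1 d2) (x - a)"
      show "\<exists>s>0. \<forall>h. h \<noteq> 0 \<and> norm (h - 0) < s \<longrightarrow>
          norm ((integral {a..x + h} f - integral {a..x} f) / h - f x) < e"
      proof (intro exI conjI allI impI)
        show "d > 0" using d1 d2 \<open>a < x\<close> by (simp add: d_def)
      next
        fix h :: real
        assume h: "h \<noteq> 0 \<and> norm (h - 0) < d"
        show "norm ((integral {a..x + h} f - integral {a..x} f) / h - f x) < e"
        proof (cases "h > 0")
          case True
          then show ?thesis
            using split[of x "x + h"] d1(2)[of h] h \<open>a < x\<close> by (simp add: d_def)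
        next
          case False
          then have "integral {a..x + h} f - integral {a..x} f = - integral {x - (- h)..x} f"
            using split[of "x + h" x] h by (simp add: d_def)
          then show ?thesis
            using d2(2)[of "- h"] False h by (simp add: d_def)
        qed
      qed
    qed
  qed
qed

lemma AE_deriv_of_indefinite_integral:
  fixes F g :: "real \<Rightarrow> real"
  assumes g: "\<And>t. a \<le> t \<Longrightarrow> integrable (lebesgue_on {a..t}) g"
    and F: "\<And>t. a \<le> t \<Longrightarrow> F t - F a = (\<integral>s. g s \<partial>lebesgue_on {a..t})"
  shows "AE t in lebesgue_on {a..}. (F has_real_derivative g t) (at t)"
proof -
  define f where "f = (\<lambda>x. if x \<in> {a..} then g x else 0)"
  have "f integrable_on {b..c}" for b c
  proof -
    have "g integrable_on {a..max a c}"
      using g by (intro integrable_on_lebesgue_on) auto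
    then have "g integrable_on {max a b..c}"
      by (rule integrable_subinterval_real) auto
    moreover have "{a..} \<inter> {b..c} = {max a b..c}" by auto
    ultimately have "g integrable_on {a..} \<inter> {b..c}" by simp
    then show ?thesis
      unfolding f_def by (subst integrable_restrict_Int)
  qed
  then obtain N where N: "negligible N"
    "\<And>b x. b < x \<Longrightarrow> x \<notin> N \<Longrightarrow> ((\<lambda>t. integral {b..t} f) has_real_derivative f x) (at x)"
    using negligible_deriv_of_integral by blast
  have F_eq: "F t = F a + integral {a..t} f" if "a \<le> t" for t
  proof -
    have "F t - F a = integral {a..t} g"
      using F[OF that] lebesgue_integral_eq_integral[OF g[OF that]] by simp
    also have "\<dots> = integral {a..t} f"
      by (rule Henstock_Kurzweil_Integration.integral_cong) (auto simp: f_def)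
    finally show ?thesis by simp
  qed
  have deriv: "(F has_real_derivative g x) (at x)" if "x \<in> {a..}" "x \<notin> insert a N" for x
  proof -
    have x: "a < x" "x \<notin> N" "f x = g x" using that by (auto simp: f_def)
    have "((\<lambda>t. F a + integral {a..t} f) has_real_derivative g x) (at x)"
      using N(2)[OF x(1,2)] x(3) by (auto intro!: derivative_eq_intros)
    moreover have "open {a<..}" "x \<in> {a<..}" using x(1) by auto
    moreover have "F a + integral {a..t} f = F t" if "t \<in> {a<..}" for t
      using F_eq[of t] that by simp
    ultimately show ?thesis
      by (rule has_field_derivative_transform_within_open)
  qed
  \<comment> \<open>The endpoint \<open>a\<close> joins the null set, since nothing is known about \<open>F\<close> to the left of it.\<close>
  have "AE x in lebesgue. x \<notin> insert a N"
    using N(1) negligible_iff_null_sets by (intro AE_not_in) auto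
  then show ?thesis
    using deriv by (subst AE_restrict_space_iff) auto
qed

section \<open>Integration over a half-line\<close>

lemma AE_lebesgue_on_halfline:
  fixes a :: real
  assumes "\<And>T. a \<le> T \<Longrightarrow> AE t in lebesgue_on {a..T}. P t"
  shows "AE t in lebesgue_on {a..}. P t"
proof -
  have "AE t in lebesgue. \<forall>n::nat. t \<in> {a..a + real n} \<longrightarrow> P t"
    using assms by (subst AE_all_countable, subst AE_restrict_space_iff[symmetric]) auto
  then have "AE t in lebesgue. t \<in> {a..} \<longrightarrow> P t"
  proof (eventually_elim, intro impI)
    fix t
    assume t: "\<forall>n::nat. t \<in> {a..a + real n} \<longrightarrow> P t" "t \<in> {a..}"
    obtain n :: nat where "t - a \<le> real n"
      using real_arch_simple by blast
    then have "t \<in> {a..a + real n}" using t by simp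
    then show "P t" using t by blast
  qed
  then show ?thesis
    by (subst AE_restrict_space_iff) auto
qed

lemma borel_measurable_lebesgue_on_halfline:
  fixes a :: real and f :: "real \<Rightarrow> real"
  assumes "\<And>T. a \<le> T \<Longrightarrow> f \<in> borel_measurable (lebesgue_on {a..T})"
  shows "f \<in> borel_measurable (lebesgue_on {a..})"
proof (rule measurable_piecewise_restrict)
  show "countable (range (\<lambda>n::nat. {a..a + real n}))" by simp
  show "space (lebesgue_on {a..}) \<subseteq> \<Union> (range (\<lambda>n::nat. {a..a + real n}))"
  proof
    fix x assume x: "x \<in> space (lebesgue_on {a..})"
    obtain n :: nat where "x - a \<le> real n"
      using real_arch_simple by blast
    then have "x \<in> {a..a + real n}" using x by simp
    then show "x \<in> \<Union> (range (\<lambda>n::nat. {a..a + real n}))" by blast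
  qed
next
  fix I assume "I \<in> range (\<lambda>n::nat. {a..a + real n})"
  then obtain n where I: "I = {a..a + real n}" by auto
  then have "{a..} \<inter> I = I" by auto
  then show "f \<in> borel_measurable (restrict_space (lebesgue_on {a..}) I)"
    using assms[of "a + real n"] by (simp add: restrict_restrict_space I)
  show "I \<inter> space (lebesgue_on {a..}) \<in> sets (lebesgue_on {a..})"
    by (auto simp: I sets_restrict_space)
qed

lemma integrable_halfline_if_bounded:
  fixes a :: real and p :: "real \<Rightarrow> real"
  assumes p: "\<And>T. a \<le> T \<Longrightarrow> integrable (lebesgue_on {a..T}) p"
    and nonneg: "\<And>t. 0 \<le> p t"
    and bound: "\<And>T. a \<le> T \<Longrightarrow> (\<integral>t. p t \<partial>lebesgue_on {a..T}) \<le> B"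
  shows "integrable (lebesgue_on {a..}) p"
proof -
  define q where "q = (\<lambda>n::nat. \<lambda>t. indicator {a..a + real n} t *\<^sub>R p t)"
  have int_q: "integrable lebesgue (q n)" for n
    using p[of "a + real n"] unfolding q_def by (simp add: integrable_restrict_space)
  have integral_q: "integral\<^sup>L lebesgue (q n) = (\<integral>t. p t \<partial>lebesgue_on {a..a + real n})" for n
    unfolding q_def by (subst integral_restrict_space) auto
  have mono_q: "q m t \<le> q n t" if "m \<le> n" for m n t
    using that nonneg[of t] by (auto simp: q_def indicator_def)
  have conv_int: "convergent (\<lambda>n. integral\<^sup>L lebesgue (q n))"
  proof (rule Bseq_mono_convergent)
    have "0 \<le> integral\<^sup>L lebesgue (q n)" for n
      using nonneg by (auto simp: q_def)
    then show "Bseq (\<lambda>n. integral\<^sup>L lebesgue (q n))"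
      using bound integral_q by (intro BseqI'[where K = B]) auto
  qed (use int_q mono_q in \<open>auto intro!: integral_mono\<close>)
  have lim: "(\<lambda>n. q n t) \<longlonglongrightarrow> indicator {a..} t *\<^sub>R p t" for t
  proof (rule tendsto_eventually)
    obtain m :: nat where "t - a \<le> real m"
      using real_arch_simple by blast
    then have "q n t = indicator {a..} t *\<^sub>R p t" if "m \<le> n" for n
      using that by (auto simp: q_def indicator_def)
    then show "\<forall>\<^sub>F n in sequentially. q n t = indicator {a..} t *\<^sub>R p t"
      by (rule eventually_sequentiallyI)
  qed
  have "(\<lambda>t. indicator {a..} t *\<^sub>R p t) \<in> borel_measurable lebesgue"
    by (rule borel_measurable_LIMSEQ_real[OF lim borel_measurable_integrable[OF int_q]])
  then have "integrable lebesgue (\<lambda>t. indicator {a..} t *\<^sub>R p t)"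
    by (intro integrable_monotone_convergence[OF int_q _ _ convergent_LIMSEQ_iff[THEN iffD1, OF conv_int]]
        AE_I2 lim monoI mono_q)
  then show ?thesis
    by (subst integrable_restrict_space) auto
qed

lemma tail_integral_tendsto_zero:
  fixes a :: real and p :: "real \<Rightarrow> real"
  assumes p: "integrable (lebesgue_on {a..}) p"
  shows "((\<lambda>T. \<integral>t. p t \<partial>lebesgue_on {T..}) \<longlongrightarrow> 0) at_top"
proof -
  let ?q = "\<lambda>t. indicator {a..} t *\<^sub>R p t"
  have q: "integrable lebesgue ?q"
    using p by (subst (asm) integrable_restrict_space) auto
  have "((\<lambda>T. \<integral>t. indicator {T..} t *\<^sub>R ?q t \<partial>lebesgue) \<longlongrightarrow> (\<integral>t. 0 \<partial>(lebesgue :: real measure))) at_top"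
  proof (rule integral_dominated_convergence_at_top[where w = "\<lambda>t. norm (?q t)"])
    have "((\<lambda>T. indicator {T..} t *\<^sub>R ?q t) \<longlongrightarrow> 0) at_top" for t
      by (rule tendsto_eventually, rule eventually_mono[OF eventually_gt_at_top[of t]]) simp
    then show "AE t in lebesgue. ((\<lambda>T. indicator {T..} t *\<^sub>R ?q t) \<longlongrightarrow> 0) at_top"
      by simp
    show "\<forall>\<^sub>F T in at_top. AE t in lebesgue. norm (indicator {T..} t *\<^sub>R ?q t) \<le> norm (?q t)"
      by (auto simp: indicator_def)
    show "(\<lambda>t. indicator {T..} t *\<^sub>R ?q t) \<in> borel_measurable lebesgue" for T :: real
      using q by (intro borel_measurable_scaleR borel_measurable_indicator borel_measurable_integrable) auto
  qed (use q in auto)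
  moreover have "\<forall>\<^sub>F T in at_top.
      (\<integral>t. indicator {T..} t *\<^sub>R ?q t \<partial>lebesgue) = (\<integral>t. p t \<partial>lebesgue_on {T..})"
    using eventually_ge_at_top[of a]
  proof eventually_elim
    fix T assume "a \<le> T"
    then show "(\<integral>t. indicator {T..} t *\<^sub>R ?q t \<partial>lebesgue) = (\<integral>t. p t \<partial>lebesgue_on {T..})"
      by (subst integral_restrict_space) (auto intro!: Bochner_Integration.integral_cong simp: indicator_def)
  qed
  ultimately show ?thesis
    by (simp add: tendsto_cong)
qed

section \<open>Energy balance from a bound on the rate\<close>

lemma energy_balance_from_rate:
  fixes e g p :: "real \<Rightarrow> real"
  assumes g: "\<And>t. 0 \<le> t \<Longrightarrow> integrable (lebesgue_on {0..t}) g"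
    and e: "\<And>t. 0 \<le> t \<Longrightarrow> e t - e 0 = (\<integral>s. g s \<partial>lebesgue_on {0..t})"
    and p: "\<And>t. 0 \<le> t \<Longrightarrow> integrable (lebesgue_on {0..t}) p"
    and rate: "AE t in lebesgue_on {0..}. g t \<le> - c * p t"
    and st: "0 \<le> s" "s \<le> t"
  shows "e t + c * (\<integral>r. p r \<partial>lebesgue_on {s..t}) \<le> e s"
proof -
  have sub: "{s..t} \<subseteq> {0..t}" using st by auto
  have g_st: "integrable (lebesgue_on {s..t}) g" and p_st: "integrable (lebesgue_on {s..t}) p"
    using st by (intro Equivalence_Lebesgue_Henstock_Integration.integrable_subinterval[OF _ sub] g p; simp)+
  have "e t - e s = (\<integral>r. g r \<partial>lebesgue_on {s..t})"
    using Equivalence_Measurable_On_Borel.integral_combine[of 0 t g s] g[of t] e[of s] e[of t] st by simp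
  also have "\<dots> \<le> (\<integral>r. - c * p r \<partial>lebesgue_on {s..t})"
  proof (rule integral_mono_AE)
    show "AE r in lebesgue_on {s..t}. g r \<le> - c * p r"
      using rate st by (subst AE_restrict_space_iff; subst (asm) AE_restrict_space_iff) (auto elim: eventually_mono)
  qed (use g_st p_st in auto)
  finally show ?thesis by simp
qed

section \<open>Testing the perturbation equation with the perturbation\<close>

lemma V_inner_self: "V_inner D w w = (V_norm D w)\<^sup>2"
  by (simp add: V_inner_def V_norm_def L2_inner_def L2_norm_def dot_square_norm)

lemma L2_norm_nonneg: "0 \<le> L2_norm D w"
  by (simp add: L2_norm_def)

lemma V_norm_nonneg: "0 \<le> V_norm D w"
  by (simp add: V_norm_def L2_norm_nonneg)

lemma in_L2_V_halfline:
  assumes v: "\<And>T. 0 \<le> T \<Longrightarrow> in_L2_V D {0..T} v"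
    and bound: "\<And>T. 0 \<le> T \<Longrightarrow> (\<integral>t. (V_norm D (v t))\<^sup>2 \<partial>lebesgue_on {0..T}) \<le> B"
  shows "in_L2_V D {0..} v"
  using v bound unfolding in_L2_V_def
  by (auto intro!: AE_lebesgue_on_halfline borel_measurable_lebesgue_on_halfline
      integrable_halfline_if_bounded[where B = B])

text \<open>
  The equation holds on all of \<open>V\<close> for almost every time; so, for almost every \<open>t\<close>, the test function
  may be the value \<open>v t\<close> at that same time.
\<close>

lemma energy_dissipation_bound:
  fixes v' :: "real \<Rightarrow> 'n::finite functional"
  assumes perturbation: "perturbation_solution D \<nu> U v v'"
    and closes: "energy_method_closes D U v v'"
    and gamma_nonneg: "\<gamma> \<ge> 0"
    and gamma: "\<And>w. w \<in> space_V D \<Longrightarrow> \<bar>advect D w U w\<bar> \<le> \<gamma> * L2_norm D w * V_norm D w"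
    and poincare: "\<And>w. w \<in> space_V D \<Longrightarrow> L2_norm D w \<le> C * V_norm D w"
  shows "AE t in lebesgue_on {0..}. v' t (v t) \<le> - (\<nu> - \<gamma> * C) * (V_norm D (v t))\<^sup>2"
proof -
  have "AE t in lebesgue_on {0..}. v t \<in> space_V D"
    using perturbation by (intro AE_lebesgue_on_halfline) (auto simp: perturbation_solution_def in_L2_V_def)
  moreover have "AE t in lebesgue_on {0..}. \<forall>\<phi> \<in> space_V D.
        v' t \<phi>
        + leray D (\<lambda>\<psi>. advect D U (v t) \<psi> + advect D (v t) U \<psi> + advect D (v t) (v t) \<psi>) \<phi>
        - \<nu> * leray D (laplacian D (v t)) \<phi> = 0"
    using perturbation by (simp add: perturbation_solution_def)
  moreover have "AE t in lebesgue_on {0..}. advect D U (v t) (v t) = 0 \<and> advect D (v t) (v t) (v t) = 0"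
    using closes by (simp add: energy_method_closes_def)
  ultimately show ?thesis
  proof eventually_elim
    case (elim t)
    let ?w = "v t"
    have "v' t ?w = - advect D ?w U ?w - \<nu> * (V_norm D ?w)\<^sup>2"
      using elim by (auto simp: leray_def laplacian_def V_inner_self)
    moreover have "- advect D ?w U ?w \<le> \<gamma> * C * (V_norm D ?w)\<^sup>2"
    proof -
      have "- advect D ?w U ?w \<le> \<gamma> * L2_norm D ?w * V_norm D ?w"
        using gamma elim(1) by fastforce
      also have "\<dots> \<le> \<gamma> * (C * V_norm D ?w) * V_norm D ?w"
        using poincare elim(1) gamma_nonneg V_norm_nonneg by (intro mult_right_mono mult_left_mono)
      finally show ?thesis by (simp add: power2_eq_square)
    qed
    ultimately show ?case by (simp add: algebra_simps)
  qed
qed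

section \<open>Energy stability\<close>

theorem proposition6p1:
  fixes D :: "('n::finite) flow_domain"
    and \<nu> \<gamma>\<^sub>U C\<^sub>P :: real
    and f :: "'n functional"
    and U :: "real ^ 'n \<Rightarrow> real ^ 'n"
    and v :: "real \<Rightarrow> real ^ 'n \<Rightarrow> real ^ 'n"
    and v' :: "real \<Rightarrow> 'n functional"
  assumes dim: "CARD('n) \<in> {2, 3}"
    and domain: "valid_domain D"
    and viscosity: "\<nu> > 0"
    and forcing: "f \<in> V_dual D"
    and steady: "steady_NS D \<nu> f U"
    and perturbation: "perturbation_solution D \<nu> U v v'"
    and closes: "energy_method_closes D U v v'"
    and gamma_nonneg: "\<gamma>\<^sub>U \<ge> 0"
    and gamma: "\<And>w. w \<in> space_V D \<Longrightarrow> \<bar>advect D w U w\<bar> \<le> \<gamma>\<^sub>U * L2_norm D w * V_norm D w"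
    and poincare: "\<And>w. w \<in> space_V D \<Longrightarrow> L2_norm D w \<le> C\<^sub>P * V_norm D w"
    and stable: "\<nu> > \<gamma>\<^sub>U * C\<^sub>P"
  shows "(AE t in lebesgue_on {0..}. \<exists>E'.
            ((\<lambda>s. (L2_norm D (v s))\<^sup>2) has_real_derivative E') (at t) \<and>
            1 / 2 * E' + (\<nu> - \<gamma>\<^sub>U * C\<^sub>P) * (V_norm D (v t))\<^sup>2 \<le> 0)
       \<and> (\<forall>s t. 0 \<le> s \<and> s \<le> t \<longrightarrow> L2_norm D (v t) \<le> L2_norm D (v s))
       \<and> in_L2_V D {0..} v
       \<and> ((\<lambda>T. L2_V_norm D {T..} v) \<longlongrightarrow> 0) at_top"
proof -
  define c where "c = \<nu> - \<gamma>\<^sub>U * C\<^sub>P"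
  define e where "e = (\<lambda>t. (L2_norm D (v t))\<^sup>2)"
  define g where "g = (\<lambda>t. 2 * v' t (v t))"
  define p where "p = (\<lambda>t. (V_norm D (v t))\<^sup>2)"
  have c: "0 < c" using stable by (simp add: c_def)
  have v_L2: "in_L2_V D {0..T} v" if "0 \<le> T" for T
    using perturbation that by (simp add: perturbation_solution_def)
  have p: "integrable (lebesgue_on {0..T}) p" if "0 \<le> T" for T
    using v_L2[OF that] by (simp add: in_L2_V_def p_def)
  have g: "integrable (lebesgue_on {0..t}) g"
    and e: "e t - e 0 = (\<integral>s. g s \<partial>lebesgue_on {0..t})" if "0 \<le> t" for t
    using closes that by (force simp: energy_method_closes_def g_def e_def)+
  have "AE t in lebesgue_on {0..}. v' t (v t) \<le> - (\<nu> - \<gamma>\<^sub>U * C\<^sub>P) * (V_norm D (v t))\<^sup>2"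
    using perturbation closes gamma_nonneg gamma poincare by (rule energy_dissipation_bound)
  then have rate: "AE t in lebesgue_on {0..}. g t \<le> - (2 * c) * p t"
    by eventually_elim (simp add: g_def p_def c_def algebra_simps)
  have balance: "e t + 2 * c * (\<integral>r. p r \<partial>lebesgue_on {s..t}) \<le> e s" if "0 \<le> s" "s \<le> t" for s t
    using energy_balance_from_rate[OF g e p rate that] .

  have "AE t in lebesgue_on {0..}. (e has_real_derivative g t) (at t)"
    by (rule AE_deriv_of_indefinite_integral[OF g e])
  with rate have inequality: "AE t in lebesgue_on {0..}. \<exists>E'. (e has_real_derivative E') (at t) \<and>
      1 / 2 * E' + c * p t \<le> 0"
    by eventually_elim (auto intro!: exI)

  have dissipation_nonneg: "0 \<le> (\<integral>r. p r \<partial>lebesgue_on {s..t})" for s t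
    by (simp add: p_def)
  have mono: "L2_norm D (v t) \<le> L2_norm D (v s)" if "0 \<le> s" "s \<le> t" for s t
  proof -
    have "e t \<le> e s"
      using balance[OF that] mult_nonneg_nonneg[OF _ dissipation_nonneg[of s t], of "2 * c"] c by simp
    then show ?thesis
      unfolding e_def using L2_norm_nonneg by (rule power2_le_imp_le)
  qed

  have "(\<integral>t. p t \<partial>lebesgue_on {0..T}) \<le> e 0 / (2 * c)" if "0 \<le> T" for T
  proof -
    have "0 \<le> e T" by (simp add: e_def)
    then show ?thesis
      using balance[of 0 T] that c by (simp add: field_simps)
  qed
  then have L2: "in_L2_V D {0..} v"
    using v_L2 unfolding p_def by (intro in_L2_V_halfline)
  then have "((\<lambda>T. \<integral>t. p t \<partial>lebesgue_on {T..}) \<longlongrightarrow> 0) at_top"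
    unfolding p_def in_L2_V_def by (intro tail_integral_tendsto_zero) auto
  then have "((\<lambda>T. L2_V_norm D {T..} v) \<longlongrightarrow> 0) at_top"
    unfolding L2_V_norm_def p_def by (drule_tac tendsto_real_sqrt) simp
  then show ?thesis
    using inequality mono L2 unfolding e_def p_def c_def by blast
qed

end
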